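(* Assume $\mu$ is absolutely continuous with respect to Lebesgue measure, and let $P^*$ be the Wasserstein distance (optimal transport cost) of the semi-discrete problem. Let $w_r$ be the width of the $r$-th iteration of the boundary method. Suppose $B\subseteq\bar{B}^r$ and that there exists some $L$ such that $|\bar{B}^r|=w_r^d L<\infty$ with respect to the $d$-dimensional Lebesgue measure. If $\gamma_{\max}<\infty$ is the maximum error of the ground cost in the set $\bar{B}^r$, and $\widetilde{P}^*$ is the Wasserstein distance approximation obtained with the boundary method, then the value of (the density of) $\mu$ on $A$ is bounded by some $M<\infty$ and $$\left|\widetilde{P}^*-P^*\right|\le w_r^d\,L\,M\,\gamma_{\max}.$$
   Context: Semi-discrete problem: $X,Y\subseteq\mathbb{R}^d$; $\mu$ is a probability measure on $X$, absolutely continuous with respect to Lebesgue measure (its density is also written $\mu(\mathbf{x})$), with support contained in $A=[0,l]^d\subseteq X$; $\nu$ is a probability measure on $Y$ with exactly $n\ge2$ non-zero values, at distinct points $\mathbf{y}_1,\dots,\mathbf{y}_n$; the cost is $c(\mathbf{x},\mathbf{y})=\|\mathbf{x}-\mathbf{y}\|_p$ with $p\in(1,\infty)$. $P^*=\min_\pi\int c\,d\pi$ over couplings $\pi$ of $\mu$ and $\nu$, attained by an optimal transport map $T$. Shift characterization: for shifts $a_1,\dots,a_n\in\mathbb{R}$ set $F(\mathbf{x})=\max_i\{a_i-c(\mathbf{x},\mathbf{y}_i)\}$ and $A_i=\{\mathbf{x}\in A:F(\mathbf{x})=a_i-c(\mathbf{x},\mathbf{y}_i)\}$; the shifts are such that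 the mass transported from $A_i$ to $\mathbf{y}_i$ by an optimal plan equals $\nu(\mathbf{y}_i)$ for every $i$. $A_{ij}=A_i\cap A_j$ ($i\ne j$), $B=\bigcup_{i<j}A_{ij}$, $\mathring{A}_i=A_i\setminus B$, and $T(\mathbf{x})=\mathbf{y}_i$ for $\mathbf{x}\in\mathring A_i$. Discretization: at iteration $r$ a Cartesian grid of axis-parallel boxes of width $w_r$ is used; $\mathbf{x}^r$ is the box of width $w_r$ centered at $\mathbf{x}$. $A^r$ is the finite set of centers of the boxes retained at iteration $r$: for $r=1$ the boxes subdivide $A$; for $r>1$ they are obtained by subdividing, to width $w_r<w_{r-1}$, the boxes centered at points of $B^{r-1}$; boxes of $\mu$-measure zero are discarded. With $\mathcal{V}=\{-1,0,1\}^d\setminus\{0\}$ and $A_i^r=A_i\cap A^r$, let $\mathring{A}_i^r=\{\mathbf{x}\in A_i^r:\ \forall \mathbf{v}\in\mathcal{V},\ \mathbf{x}+w_r\mathbf{v}\in A_j^r\Rightarrow j=i\}$, $B^r=A^r\setminus\bigcup_i\mathring{A}_i^r$, and $\bar{B}^r=\bigcup_{\mathbf{x}\in B^r}\mathbf{x}^r$. Boundary method output after iteration $r$: points of $A\setminus\bar{B}^r$ have been identified as lying in the interior of the correct $A_i$ and are assigned to $\mathbf{y}_i$ exactly; points of $\bar{B}^r$ are assigned to destinations among $\mathbf{y}_1,\dots,\mathbf{y}_n$ by an approximate map. Writing $\widetilde{T}$ for the resulting approximate transport map (so $\widetilde{T}=T$ on $A\setminus\bar{B}^r$), $\widetilde{P}^*=\int_A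 c(\mathbf{x},\widetilde{T}(\mathbf{x}))\,d\mu(\mathbf{x})$, all integrals being computed exactly. The error of the ground cost at $\mathbf{x}$ is $|c(\mathbf{x},T(\mathbf{x}))-c(\mathbf{x},\widetilde{T}(\mathbf{x}))|$, and $\gamma_{\max}$ is its maximum over $\bar{B}^r$.
   Formalization: Absolute continuity alone does not bound the density on A (e.g. 1/(2√x) on [0,1]); it is additionally assumed that each point of A has a neighbourhood where the density of μ is essentially bounded. Bounds on the density are almost everywhere. *)

theory Defs
  imports "HOL-Probability.Probability"
begin

definition pnorm :: "real \<Rightarrow> real^'d \<Rightarrow> real" where
  "pnorm p v = (\<Sum>k\<in>UNIV. \<bar>v $ k\<bar> powr p) powr (1 / p)"

definition pcost :: "real \<Rightarrow> real^'d \<Rightarrow> real^'d \<Rightarrow> real" where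
  "pcost p x z = pnorm p (x - z)"

definition couplings :: "(real^'d) measure \<Rightarrow> (real^'d) measure \<Rightarrow> ((real^'d) \<times> (real^'d)) measure set" where
  "couplings \<mu> \<nu> = {\<pi>. sets \<pi> = sets borel \<and> distr \<pi> borel fst = \<mu> \<and> distr \<pi> borel snd = \<nu>}"

definition plan_cost :: "(real^'d \<Rightarrow> real^'d \<Rightarrow> real) \<Rightarrow> ((real^'d) \<times> (real^'d)) measure \<Rightarrow> ennreal" where
  "plan_cost c \<pi> = (\<integral>\<^sup>+z. ennreal (c (fst z) (snd z)) \<partial>\<pi>)"

definition ot_cost ::
    "(real^'d \<Rightarrow> real^'d \<Rightarrow> real) \<Rightarrow> (real^'d) measure \<Rightarrow> (real^'d) measure \<Rightarrow> ennreal" where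
  "ot_cost c \<mu> \<nu> = (INF \<pi>\<in>couplings \<mu> \<nu>. plan_cost c \<pi>)"

definition optimal_plan ::
    "(real^'d \<Rightarrow> real^'d \<Rightarrow> real) \<Rightarrow> (real^'d) measure \<Rightarrow> (real^'d) measure \<Rightarrow>
     ((real^'d) \<times> (real^'d)) measure \<Rightarrow> bool" where
  "optimal_plan c \<mu> \<nu> \<pi> \<longleftrightarrow> \<pi> \<in> couplings \<mu> \<nu> \<and> plan_cost c \<pi> = ot_cost c \<mu> \<nu>"

definition optimal_map ::
    "(real^'d \<Rightarrow> real^'d \<Rightarrow> real) \<Rightarrow> (real^'d) measure \<Rightarrow> (real^'d) measure \<Rightarrow>
     (real^'d \<Rightarrow> real^'d) \<Rightarrow> bool" where
  "optimal_map c \<mu> \<nu> T \<longleftrightarrow> T \<in> borel_measurable \<mu> \<and> distr \<mu> borel T = \<nu> \<and>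
     (\<integral>\<^sup>+x. ennreal (c x (T x)) \<partial>\<mu>) = ot_cost c \<mu> \<nu>"

definition msupport :: "(real^'d) measure \<Rightarrow> (real^'d) set" where
  "msupport \<mu> = {x. \<forall>U. open U \<and> x \<in> U \<longrightarrow> emeasure \<mu> U > 0}"

text \<open>Densities are only determined up to Lebesgue-null sets, so bounds on the values of
  the density are understood almost everywhere.\<close>

definition density_le :: "(real^'d) measure \<Rightarrow> (real^'d) set \<Rightarrow> real \<Rightarrow> bool" where
  "density_le \<mu> S M \<longleftrightarrow> (AE x in lborel. x \<in> S \<longrightarrow> RN_deriv lborel \<mu> x \<le> ennreal M)"

text \<open>Absolute continuity alone does not make the density bounded on a compact set
  (consider the density \<open>1 / (2 * sqrt x)\<close> on \<open>[0, 1]\<close>). Local boundedness, which holds for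
  example for continuous densities, is the regularity that does.\<close>

definition locally_bounded_density :: "(real^'d) measure \<Rightarrow> (real^'d) set \<Rightarrow> bool" where
  "locally_bounded_density \<mu> S \<longleftrightarrow>
     (\<forall>x\<in>S. \<exists>U K. open U \<and> x \<in> U \<and> density_le \<mu> (S \<inter> U) K)"

text \<open>In what follows \<open>n\<close> is the number of sites, \<open>y 1, \<dots>, y n\<close> are the sites and
  \<open>a 1, \<dots>, a n\<close> are the shifts.\<close>

definition cube :: "real \<Rightarrow> (real^'d) set" where
  "cube l = cbox 0 (\<chi> k. l)"

definition shift_max ::
    "(real^'d \<Rightarrow> real^'d \<Rightarrow> real) \<Rightarrow> nat \<Rightarrow> (nat \<Rightarrow> real^'d) \<Rightarrow> (nat \<Rightarrow> real) \<Rightarrow> real^'d \<Rightarrow> real" where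
  "shift_max c n y a x = Max ((\<lambda>i. a i - c x (y i)) ` {1..n})"

definition region ::
    "(real^'d \<Rightarrow> real^'d \<Rightarrow> real) \<Rightarrow> (real^'d) set \<Rightarrow> nat \<Rightarrow> (nat \<Rightarrow> real^'d) \<Rightarrow> (nat \<Rightarrow> real) \<Rightarrow>
     nat \<Rightarrow> (real^'d) set" where
  "region c A n y a i = {x \<in> A. shift_max c n y a x = a i - c x (y i)}"

definition boundary_set :: "nat \<Rightarrow> (nat \<Rightarrow> (real^'d) set) \<Rightarrow> (real^'d) set" where
  "boundary_set n R = (\<Union>j\<in>{1..n}. \<Union>i\<in>{1..<j}. R i \<inter> R j)"

definition optimal_shifts ::
    "(real^'d \<Rightarrow> real^'d \<Rightarrow> real) \<Rightarrow> (real^'d) set \<Rightarrow> (real^'d) measure \<Rightarrow> (real^'d) measure \<Rightarrow>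
     nat \<Rightarrow> (nat \<Rightarrow> real^'d) \<Rightarrow> (nat \<Rightarrow> real) \<Rightarrow> bool" where
  "optimal_shifts c A \<mu> \<nu> n y a \<longleftrightarrow>
     (\<exists>\<pi>. optimal_plan c \<mu> \<nu> \<pi> \<and>
       (\<forall>i\<in>{1..n}. measure \<pi> (region c A n y a i \<times> {y i}) = measure \<nu> {y i}))"

definition gbox :: "real \<Rightarrow> real^'d \<Rightarrow> (real^'d) set" where
  "gbox w x = cbox (\<chi> k. x $ k - w / 2) (\<chi> k. x $ k + w / 2)"

text \<open>The centers of the boxes of width \<open>w\<close> into which the box of width \<open>w'\<close> centered at \<open>x\<close>
  is subdivided, when \<open>w'\<close> is an integer multiple of \<open>w\<close>.\<close>

definition subcenters :: "real \<Rightarrow> real \<Rightarrow> real^'d \<Rightarrow> (real^'d) set" where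
  "subcenters w' w x =
     {z. \<forall>k. \<exists>m::nat. real (m + 1) * w \<le> w' \<and> z $ k = x $ k - w' / 2 + (real m + 1 / 2) * w}"

text \<open>Subdivide the boxes of width \<open>w'\<close> centered in \<open>S\<close>, discarding boxes of measure zero.\<close>

definition refine :: "(real^'d) measure \<Rightarrow> real \<Rightarrow> real \<Rightarrow> (real^'d) set \<Rightarrow> (real^'d) set" where
  "refine \<mu> w' w S = {z \<in> (\<Union>x\<in>S. subcenters w' w x). emeasure \<mu> (gbox w z) \<noteq> 0}"

definition directions :: "(real^'d) set" where
  "directions = {v. \<forall>k. v $ k \<in> {-1, 0, 1}} - {0}"

definition interior_centers ::
    "nat \<Rightarrow> (nat \<Rightarrow> (real^'d) set) \<Rightarrow> real \<Rightarrow> (real^'d) set \<Rightarrow> nat \<Rightarrow> (real^'d) set" where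
  "interior_centers n R w S i =
     {x \<in> R i \<inter> S. \<forall>v\<in>directions. \<forall>j\<in>{1..n}. x + w *\<^sub>R v \<in> R j \<inter> S \<longrightarrow> j = i}"

definition boundary_centers ::
    "nat \<Rightarrow> (nat \<Rightarrow> (real^'d) set) \<Rightarrow> real \<Rightarrow> (real^'d) set \<Rightarrow> (real^'d) set" where
  "boundary_centers n R w S = S - (\<Union>i\<in>{1..n}. interior_centers n R w S i)"

text \<open>\<open>grid_boundary \<mu> n R w l r\<close> is the set \<open>B^r\<close> for box widths \<open>w 1, w 2, \<dots>\<close>. Iteration \<open>0\<close>
  consists, by convention, of the whole cube \<open>[0, l]^d\<close> as a single box, so that the boxes
  of the first iteration subdivide the cube; the value \<open>w 0\<close> is not used.\<close>

definition width :: "real \<Rightarrow> (nat \<Rightarrow> real) \<Rightarrow> nat \<Rightarrow> real" where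
  "width l w r = (if r = 0 then l else w r)"

primrec grid_boundary ::
    "(real^'d) measure \<Rightarrow> nat \<Rightarrow> (nat \<Rightarrow> (real^'d) set) \<Rightarrow> (nat \<Rightarrow> real) \<Rightarrow> real \<Rightarrow> nat \<Rightarrow>
     (real^'d) set" where
  "grid_boundary \<mu> n R w l 0 = {\<chi> k. l / 2}"
| "grid_boundary \<mu> n R w l (Suc r) =
     boundary_centers n R (w (Suc r))
       (refine \<mu> (width l w r) (w (Suc r)) (grid_boundary \<mu> n R w l r))"

definition boundary_region ::
    "(real^'d) measure \<Rightarrow> nat \<Rightarrow> (nat \<Rightarrow> (real^'d) set) \<Rightarrow> (nat \<Rightarrow> real) \<Rightarrow> real \<Rightarrow> nat \<Rightarrow>
     (real^'d) set" where
  "boundary_region \<mu> n R w l r = (\<Union>x\<in>grid_boundary \<mu> n R w l r. gbox (w r) x)"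

definition valid_widths :: "real \<Rightarrow> (nat \<Rightarrow> real) \<Rightarrow> nat \<Rightarrow> bool" where
  "valid_widths l w r \<longleftrightarrow>
     (\<forall>s\<in>{1..r}. w s > 0 \<and> (\<exists>N::nat. width l w (s - 1) = real N * w s)) \<and>
     (\<forall>s\<in>{2..r}. w s < w (s - 1))"

text \<open>The maximum over \<open>S\<close> of the error of the ground cost, taken as a supremum because a maximum
  need not be attained by maps that are discontinuous on \<open>S\<close>.\<close>

definition max_ground_error ::
    "(real^'d \<Rightarrow> real^'d \<Rightarrow> real) \<Rightarrow> (real^'d \<Rightarrow> real^'d) \<Rightarrow> (real^'d \<Rightarrow> real^'d) \<Rightarrow>
     (real^'d) set \<Rightarrow> ennreal" where
  "max_ground_error c T T' S = (SUP x\<in>S. ennreal \<bar>c x (T x) - c x (T' x)\<bar>)"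

end

theory Submission
  imports Defs
begin

text \<open>The exact cost is the integral of \<open>c x (T x)\<close> over the cube, the approximate cost that
  of \<open>c x (T' x)\<close>. The two integrands agree off the boundary region, and on it they differ by
  at most the maximal ground error \<open>\<gamma>\<close>, so the costs differ by at most \<open>\<gamma>\<close> times the mass
  that \<open>\<mu>\<close> gives to the boundary region (\<open>integral_diff_le_measure\<close>). A density bound \<open>M\<close> turns
  this mass into \<open>M\<close> times a Lebesgue volume (\<open>emeasure_le_density_bound\<close>), and the volume is
  \<open>w\<^sub>r\<^sup>d L\<close> by hypothesis. The bound \<open>M\<close> itself comes from compactness of the cube: finitely many
  of the neighbourhoods on which the density is bounded suffice (\<open>density_le_compact\<close>).

  What remains is to see that the integrals are genuine. A measure lives on every closed set
  containing its support, so almost every point lies in the cube; almost every point is sent by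
  \<open>T\<close> to one of the sites, because \<open>\<nu>\<close> lives on them; and the cost is bounded on bounded
  sets. Hence both integrands are bounded almost everywhere and therefore integrable.\<close>

section \<open>The cost function\<close>

lemma borel_measurable_pcost [measurable]:
  assumes [measurable]: "f \<in> borel_measurable M" "g \<in> borel_measurable M"
  shows "(\<lambda>x. pcost p (f x) (g x :: real^'d)) \<in> borel_measurable M"
proof -
  have [measurable]: "(\<lambda>x. f x $ k) \<in> borel_measurable M" "(\<lambda>x. g x $ k) \<in> borel_measurable M" for k
    by (auto intro!: borel_measurable_continuous_on[where f="\<lambda>v. v $ k"] continuous_intros)
  show ?thesis
    unfolding pcost_def pnorm_def by simp
qed

lemma pcost_nonneg: "0 \<le> pcost p x z"
  by (simp add: pcost_def pnorm_def)

text \<open>Every coordinate of \<open>x - z\<close> is at most its Euclidean norm, and the \<open>p\<close>-norm is monotone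
  in the absolute values of the coordinates.\<close>

lemma pcost_le:
  fixes x z :: "real^'d"
  assumes "0 < p" "norm (x - z) \<le> K"
  shows "pcost p x z \<le> (real CARD('d) * K powr p) powr (1 / p)"
proof -
  have "(\<Sum>k\<in>UNIV. \<bar>(x - z) $ k\<bar> powr p) \<le> (\<Sum>k\<in>(UNIV :: 'd set). K powr p)"
    using assms by (intro sum_mono powr_mono2)
      (auto intro: order_trans[OF component_le_norm_cart] simp del: vector_minus_component)
  then show ?thesis
    unfolding pcost_def pnorm_def using assms by (auto intro!: powr_mono2 sum_nonneg)
qed

lemma pcost_bounded:
  fixes A S :: "(real^'d) set"
  assumes "0 < p" "bounded A" "bounded S"
  obtains K where "\<And>x z. x \<in> A \<Longrightarrow> z \<in> S \<Longrightarrow> pcost p x z \<le> K"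
proof -
  obtain a s where "\<And>x. x \<in> A \<Longrightarrow> norm x \<le> a" "\<And>z. z \<in> S \<Longrightarrow> norm z \<le> s"
    using assms unfolding bounded_iff by blast
  then have "norm (x - z) \<le> a + s" if "x \<in> A" "z \<in> S" for x z
    using that norm_triangle_le_diff[of x z "a + s"] by (simp add: add_mono)
  with pcost_le[OF \<open>0 < p\<close>] show thesis
    by (intro that) blast
qed

section \<open>Mass and density\<close>

text \<open>The complement of \<open>A\<close> is covered by open null sets; by the Lindeloef property countably
  many of them suffice.\<close>

lemma AE_in_closed_superset_of_msupport:
  fixes \<mu> :: "(real^'d) measure"
  assumes "sets \<mu> = sets borel" "closed A" "msupport \<mu> \<subseteq> A"
  shows "AE x in \<mu>. x \<in> A"
proof -
  let ?N = "{U. open U \<and> emeasure \<mu> U = 0}"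
  obtain F where F: "F \<subseteq> ?N" "countable F" "\<Union>F = \<Union>?N"
    using Lindelof[of ?N] by auto
  have "(\<Union>U\<in>F. U) \<in> null_sets \<mu>"
    using F assms(1) by (intro null_sets_UN') (auto intro!: null_setsI)
  moreover have "- A \<subseteq> \<Union>?N"
  proof
    fix x assume "x \<in> - A"
    with assms(3) have "x \<notin> msupport \<mu>"
      by blast
    then show "x \<in> \<Union>?N"
      unfolding msupport_def by (auto simp: not_less)
  qed
  ultimately show ?thesis
    using F by (intro AE_I'[of "\<Union>F"]) auto
qed

lemma emeasure_le_density_bound:
  fixes \<mu> :: "(real^'d) measure"
  assumes "sets \<mu> = sets borel" "absolutely_continuous lborel \<mu>" "density_le \<mu> A M"
    and [measurable]: "A \<in> sets borel" "S \<in> sets borel"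
  shows "emeasure \<mu> (A \<inter> S) \<le> ennreal M * emeasure lborel S"
proof -
  have "emeasure \<mu> (A \<inter> S) = emeasure (density lborel (RN_deriv lborel \<mu>)) (A \<inter> S)"
    using assms by (subst sigma_finite_measure.density_RN_deriv[OF sigma_finite_lborel]) auto
  also have "\<dots> = (\<integral>\<^sup>+x. RN_deriv lborel \<mu> x * indicator (A \<inter> S) x \<partial>lborel)"
    by (subst emeasure_density) auto
  also have "\<dots> \<le> (\<integral>\<^sup>+x. ennreal M * indicator S x \<partial>lborel)"
    using assms(3) unfolding density_le_def
    by (intro nn_integral_mono_AE) (auto split: split_indicator)
  also have "\<dots> = ennreal M * emeasure lborel S"
    by (simp add: nn_integral_cmult_indicator)
  finally show ?thesis .
qed

lemma density_le_compact:
  fixes \<mu> :: "(real^'d) measure"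
  assumes "compact A" "locally_bounded_density \<mu> A"
  shows "\<exists>M. density_le \<mu> A M"
proof -
  obtain U K where U: "\<And>x. x \<in> A \<Longrightarrow> open (U x)" "\<And>x. x \<in> A \<Longrightarrow> x \<in> U x"
    and K: "\<And>x. x \<in> A \<Longrightarrow> density_le \<mu> (A \<inter> U x) (K x)"
    using assms(2) unfolding locally_bounded_density_def by metis
  obtain C where C: "C \<subseteq> A" "finite C" "A \<subseteq> (\<Union>x\<in>C. U x)"
    using compactE_image[OF assms(1), of A U] U by blast
  define M where "M = Max (insert 0 (K ` C))"
  have "AE x in lborel. \<forall>z\<in>C. x \<in> A \<inter> U z \<longrightarrow> RN_deriv lborel \<mu> x \<le> ennreal (K z)"
    using C K by (intro AE_finite_allI) (auto simp: density_le_def)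
  moreover have KM: "ennreal (K z) \<le> ennreal M" if "z \<in> C" for z
    using that C by (auto simp: M_def intro!: ennreal_leI Max_ge)
  ultimately have "density_le \<mu> A M"
    unfolding density_le_def
  proof (elim eventually_mono, intro impI)
    fix x
    assume bound: "\<forall>z\<in>C. x \<in> A \<inter> U z \<longrightarrow> RN_deriv lborel \<mu> x \<le> ennreal (K z)" and "x \<in> A"
    with C obtain z where "z \<in> C" "x \<in> U z"
      by blast
    with bound \<open>x \<in> A\<close> have "RN_deriv lborel \<mu> x \<le> ennreal (K z)"
      by blast
    also have "\<dots> \<le> ennreal M"
      using \<open>z \<in> C\<close> by (rule KM)
    finally show "RN_deriv lborel \<mu> x \<le> ennreal M" .
  qed
  then show ?thesis ..
qed

section \<open>Measurability of the boundary region\<close>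

text \<open>Without this the Lebesgue measure of the boundary region would say nothing about its mass.
  Countably many boxes are enough, so it suffices that a center is given by a vector of naturals.\<close>

lemma countable_subcenters: "countable (subcenters w' w (x :: real^'d))"
proof -
  let ?g = "\<lambda>m::nat. \<lambda>k. x $ k - w' / 2 + (real m + 1 / 2) * w"
  have "countable {z. \<forall>k. z $ k \<in> range (\<lambda>m. ?g m k)}"
    by (intro countable_vector) auto
  then show ?thesis
    by (rule countable_subset[rotated]) (auto simp: subcenters_def)
qed

lemma countable_grid_boundary: "countable (grid_boundary \<mu> n R w l r)"
proof (induction r)
  case (Suc r)
  then have "countable (refine \<mu> (width l w r) (w (Suc r)) (grid_boundary \<mu> n R w l r))"
    unfolding refine_def
    by (intro countable_subset[OF Collect_restrict] countable_UN countable_subcenters)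
  then show ?case
    by (auto simp: boundary_centers_def)
qed auto

lemma boundary_region_borel: "boundary_region \<mu> n R w l r \<in> sets borel"
  unfolding boundary_region_def gbox_def
  by (intro sets.countable_UN' countable_grid_boundary) auto

section \<open>The error estimate\<close>

lemma integral_diff_le_measure:
  fixes f g :: "'a \<Rightarrow> real"
  assumes "finite_measure M" "integrable M f" "integrable M g" "S \<in> sets M"
    and off: "AE x in M. x \<notin> S \<longrightarrow> f x = g x"
    and on: "AE x in M. x \<in> S \<longrightarrow> \<bar>f x - g x\<bar> \<le> \<gamma>"
  shows "\<bar>(\<integral>x. f x \<partial>M) - (\<integral>x. g x \<partial>M)\<bar> \<le> \<gamma> * measure M S"
proof -
  interpret finite_measure M by fact
  have "\<bar>(\<integral>x. f x \<partial>M) - (\<integral>x. g x \<partial>M)\<bar> = \<bar>\<integral>x. f x - g x \<partial>M\<bar>"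
    using assms by simp
  also have "\<dots> \<le> (\<integral>x. \<bar>f x - g x\<bar> \<partial>M)"
    by (rule integral_abs_bound)
  also have "\<dots> \<le> (\<integral>x. \<gamma> * indicator S x \<partial>M)"
    using off on assms(2-4)
    by (intro integral_mono_AE) (auto split: split_indicator simp: less_top[symmetric])
  also have "\<dots> = \<gamma> * measure M S"
    using assms(4) sets.sets_into_space by (simp add: Int_absorb2)
  finally show ?thesis .
qed

lemma ground_error_le_max:
  assumes "max_ground_error c T T' S < \<infinity>" "x \<in> S"
  shows "\<bar>c x (T' x) - c x (T x)\<bar> \<le> enn2real (max_ground_error c T T' S)"
proof -
  have "ennreal \<bar>c x (T x) - c x (T' x)\<bar> \<le> max_ground_error c T T' S"
    unfolding max_ground_error_def using assms(2) by (rule SUP_upper)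
  then have "enn2real (ennreal \<bar>c x (T x) - c x (T' x)\<bar>) \<le> enn2real (max_ground_error c T T' S)"
    using assms(1) by (intro enn2real_mono) auto
  then show ?thesis
    by (simp add: abs_minus_commute)
qed

theorem theorem3p25:
  fixes p l L :: real and n r :: nat
    and X Y A B Bbar :: "(real^'d) set"
    and \<mu> \<nu> :: "(real^'d) measure"
    and c :: "real^'d \<Rightarrow> real^'d \<Rightarrow> real"
    and y :: "nat \<Rightarrow> real^'d" and a w :: "nat \<Rightarrow> real"
    and R :: "nat \<Rightarrow> (real^'d) set"
    and T T' :: "real^'d \<Rightarrow> real^'d"
  defines "c \<equiv> pcost p"
    and "A \<equiv> cube l"
    and "R \<equiv> region c A n y a"
    and "B \<equiv> boundary_set n R"
    and "Bbar \<equiv> boundary_region \<mu> n R w l r"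
  assumes p: "1 < p" and l: "0 < l" and AX: "A \<subseteq> X"
    and mu: "prob_space \<mu>" "sets \<mu> = sets borel" "msupport \<mu> \<subseteq> A"
    and mu_ac: "absolutely_continuous lborel \<mu>"
    and mu_locally_bounded: "locally_bounded_density \<mu> A"
    and nu: "prob_space \<nu>" "sets \<nu> = sets borel" "measure \<nu> (y ` {1..n}) = 1"
    and sites: "2 \<le> n" "inj_on y {1..n}" "y ` {1..n} \<subseteq> Y"
      "{z. measure \<nu> {z} \<noteq> 0} = y ` {1..n}"
    and shifts: "optimal_shifts c A \<mu> \<nu> n y a"
    and T_opt: "optimal_map c \<mu> \<nu> T" and T_range: "T ` X \<subseteq> Y"
    and T_regions: "\<And>i x. i \<in> {1..n} \<Longrightarrow> x \<in> R i - B \<Longrightarrow> T x = y i"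
    and widths: "1 \<le> r" "valid_widths l w r"
    and B_sub: "B \<subseteq> Bbar"
    and Bbar_measure: "emeasure lborel Bbar < \<infinity>"
      "measure lborel Bbar = w r ^ CARD('d) * L"
    and T'_meas: "T' \<in> borel_measurable \<mu>"
    and T'_exact: "\<And>x. x \<in> A - Bbar \<Longrightarrow> T' x = T x"
    and T'_approx: "\<And>x. x \<in> Bbar \<Longrightarrow> T' x \<in> y ` {1..n}"
    and gamma_finite: "max_ground_error c T T' Bbar < \<infinity>"
  shows "(\<exists>M. density_le \<mu> A M) \<and>
    (\<forall>M. density_le \<mu> A M \<longrightarrow>
      \<bar>(LINT x:A|\<mu>. c x (T' x)) - enn2real (ot_cost c \<mu> \<nu>)\<bar>
        \<le> w r ^ CARD('d) * L * M * enn2real (max_ground_error c T T' Bbar))"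
proof (intro conjI allI impI)
  have A: "compact A"
    by (simp add: A_def cube_def)
  then show "\<exists>M. density_le \<mu> A M"
    using mu_locally_bounded by (rule density_le_compact)
  fix M assume M: "density_le \<mu> A M"
  interpret prob_space \<mu> by fact
  let ?\<gamma> = "enn2real (max_ground_error c T T' Bbar)"
  let ?f' = "\<lambda>x. c x (T' x)" and ?f = "\<lambda>x. c x (T x)"
  note [measurable_cong] = mu(2)
  have [measurable]: "A \<in> sets borel" "Bbar \<in> sets borel"
    using A by (auto simp: Bbar_def boundary_region_borel compact_imp_closed)
  have T [measurable]: "T \<in> borel_measurable \<mu>" and distr_T: "distr \<mu> borel T = \<nu>"
    and cost_T: "(\<integral>\<^sup>+x. ennreal (?f x) \<partial>\<mu>) = ot_cost c \<mu> \<nu>"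
    using T_opt by (auto simp: optimal_map_def)
  note [measurable] = T'_meas
  have [measurable]: "?f \<in> borel_measurable \<mu>" "?f' \<in> borel_measurable \<mu>"
    unfolding c_def by measurable
  have AE_A: "AE x in \<mu>. x \<in> A"
    using mu A by (intro AE_in_closed_superset_of_msupport) (auto intro: compact_imp_closed)

  have Y: "y ` {1..n} \<in> sets borel"
    by (intro borel_closed finite_imp_closed) auto
  have "AE z in \<nu>. z \<in> y ` {1..n}"
    using nu(1,3) by (rule prob_space.AE_prob_1)
  then have AE_T: "AE x in \<mu>. T x \<in> y ` {1..n}"
    unfolding distr_T[symmetric] using Y by (subst (asm) AE_distr_iff) simp_all
  have AE_T': "AE x in \<mu>. T' x \<in> y ` {1..n}"
    using AE_A AE_T by eventually_elim (metis DiffI T'_approx T'_exact)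
  obtain K where K: "\<And>x z. x \<in> A \<Longrightarrow> z \<in> y ` {1..n} \<Longrightarrow> c x z \<le> K"
    using pcost_bounded[of p A "y ` {1..n}"] p A unfolding c_def
    by (auto intro: compact_imp_bounded)
  have c_nonneg: "0 \<le> c x z" for x z
    by (simp add: c_def pcost_nonneg)
  have int: "integrable \<mu> ?f"
    using AE_A AE_T
    by (intro integrable_const_bound[of _ K]) (auto elim!: eventually_elim2 simp: K c_nonneg)
  have int': "integrable \<mu> ?f'"
    using AE_A AE_T'
    by (intro integrable_const_bound[of _ K]) (auto elim!: eventually_elim2 simp: K c_nonneg)

  have exact: "enn2real (ot_cost c \<mu> \<nu>) = (\<integral>x. ?f x \<partial>\<mu>)"
    unfolding cost_T[symmetric] by (subst integral_eq_nn_integral) (auto simp: c_nonneg)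
  have approx: "(LINT x:A|\<mu>. ?f' x) = (\<integral>x. ?f' x \<partial>\<mu>)"
    unfolding set_lebesgue_integral_def using AE_A by (intro integral_cong_AE) auto

  \<comment> \<open>A negative \<open>M\<close> would bound the density by \<open>0\<close>, leaving no mass on the cube.\<close>
  have "0 \<le> M"
  proof (rule ccontr)
    assume "\<not> 0 \<le> M"
    then have "emeasure \<mu> (A \<inter> UNIV) = 0"
      using emeasure_le_density_bound[OF mu(2) mu_ac M, of UNIV] by (simp add: ennreal_neg)
    moreover have "emeasure \<mu> A = 1"
      using AE_A by (intro emeasure_eq_1_AE) auto
    ultimately show False by simp
  qed
  have "emeasure \<mu> (A \<inter> Bbar) \<le> ennreal M * emeasure lborel Bbar"
    using mu(2) mu_ac M by (rule emeasure_le_density_bound) auto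
  also have "\<dots> = ennreal (M * (w r ^ CARD('d) * L))"
    using Bbar_measure \<open>0 \<le> M\<close>
    by (simp add: emeasure_eq_ennreal_measure less_top ennreal_mult' flip: Bbar_measure(2))
  finally have mass: "measure \<mu> (A \<inter> Bbar) \<le> M * (w r ^ CARD('d) * L)"
    using \<open>0 \<le> M\<close> by (simp add: emeasure_eq_measure flip: Bbar_measure(2))

  have "\<bar>(LINT x:A|\<mu>. ?f' x) - enn2real (ot_cost c \<mu> \<nu>)\<bar> \<le> ?\<gamma> * measure \<mu> (A \<inter> Bbar)"
    unfolding exact approx
  proof (rule integral_diff_le_measure)
    show "AE x in \<mu>. x \<notin> A \<inter> Bbar \<longrightarrow> ?f' x = ?f x"
      using AE_A by eventually_elim (auto simp: T'_exact)
    show "AE x in \<mu>. x \<in> A \<inter> Bbar \<longrightarrow> \<bar>?f' x - ?f x\<bar> \<le> ?\<gamma>"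
      by (intro AE_I2) (auto intro: ground_error_le_max[OF gamma_finite])
  qed (use int int' finite_measure_axioms in auto)
  also have "\<dots> \<le> ?\<gamma> * (M * (w r ^ CARD('d) * L))"
    using mass by (intro mult_left_mono) auto
  finally show "\<bar>(LINT x:A|\<mu>. ?f' x) - enn2real (ot_cost c \<mu> \<nu>)\<bar>
      \<le> w r ^ CARD('d) * L * M * ?\<gamma>"
    by (simp add: ac_simps)
qed

end
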